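(* Assume the setting described in the context. Then the smoothed Rockafellians $\Phi^\delta$ Mosco-converge to $\Phi$ as $\delta\downarrow0$ on $Z\times\mathbb R\times T\times\mathbf T$; that is: (1) for every $(z,\gamma,t,\mathbf t)\in Z\times\mathbb R\times T\times\mathbf T$ there is a sequence $(z_\delta,\gamma_\delta,t_\delta,\mathbf t_\delta)_\delta$ converging strongly to $(z,\gamma,t,\mathbf t)$ with $\limsup_{\delta\downarrow0}\Phi^\delta(z_\delta,\gamma_\delta;t_\delta,\mathbf t_\delta)\le\Phi(z,\gamma;t,\mathbf t)$; (2) for every sequence $(z_\delta,\gamma_\delta,t_\delta,\mathbf t_\delta)\rightharpoonup(z,\gamma,t,\mathbf t)$ converging weakly in $Z\times\mathbb R\times T\times\mathbf T$, $\liminf_{\delta\downarrow0}\Phi^\delta(z_\delta,\gamma_\delta;t_\delta,\mathbf t_\delta)\ge\Phi(z,\gamma;t,\mathbf t)$.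
   Context: Setting. $Z$ is a reflexive Banach space, $U$ a Banach space, $(\Xi,\mathcal A,\mathbb P)$ a probability space whose sample space $\Xi$ is a vector space with norm $\|\cdot\|_\Xi$. $f_0:Z\to\overline{\mathbb R}$, $g:U\to\overline{\mathbb R}$, $s:\Xi\times Z\to U$ satisfy: $s(\cdot,z)$ is $\mathcal A$-measurable for every $z\in Z$; if $\xi_\varepsilon\to\xi$ in $\Xi$ and $z_\varepsilon\rightharpoonup z$ in $Z$ then $s(\xi_\varepsilon,z_\varepsilon)\rightharpoonup s(\xi,z)$ in $U$; $f_0$ is proper ($f_0>-\infty$ everywhere, $f_0\not\equiv+\infty$); $f_0$ and $g$ are sequentially weakly lower semicontinuous. $\kappa=(1-\beta)^{-1}$ for some $\beta\in(0,1)$. Usual extended-real conventions apply. Measure. $\mu$ is a $\sigma$-finite measure on $(\Xi,\mathcal A)$ with $\mathbb P\ll\mu$, $\rho:=d\mathbb P/d\mu$; $L^p$ spaces refer to $\mu$. $q,q'\in(1,\infty)$, $1/q+1/q'=1$; $T:=L^q(\Xi)$, $\mathbf T:=L^{q'}(\Xi;\Xi)$. Smoothing. $\zeta:\mathbb R\to\mathbb R$ is continuous, bounded, nonnegative, $\int\zeta=1$, $\int\zeta(x)|x|dx<\infty$, either $\int_{\mathbb R}\zeta(x)x\,dx\le0$ or $\int_{-\infty}^0\zeta(x)|x|dx=0$, and $\{\zeta>0\}$ is connected. $A_\delta(\tau)=\int_{-\infty}^\tau\frac1\delta\zeta(\sigma/\delta)d\sigma$, $(x)_{+,\delta}=\int_{-\infty}^xA_\delta(\tau)d\tau$,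 $(x)_+=\max\{0,x\}$. Functionals $\Phi,\Phi^\delta:Z\times\mathbb R\times T\times\mathbf T\to\overline{\mathbb R}$: $\Phi(z,\gamma;t,\mathbf t)=f_0(z)+\gamma+\kappa\int_\Xi(g(s(\xi,z))-\gamma)_+\,\rho(\xi)\,d\mu(\xi)$ if $(t,\mathbf t)=(0,0)$ a.e., and $+\infty$ otherwise; $\Phi^\delta(z,\gamma;t,\mathbf t)=f_0(z)+\gamma+\kappa\int_\Xi(g(s(\xi,z))-\gamma)_{+,\delta}\,\rho(\xi)\,d\mu(\xi)$ if $(t,\mathbf t)=(0,0)$ a.e., and $+\infty$ otherwise. *)

theory Defs
  imports "HOL-Probability.Probability" "HOL-Library.Function_Algebras"
begin

instantiation "fun" :: (type, real_vector) real_vector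
begin

definition scaleR_fun :: "real \<Rightarrow> ('a \<Rightarrow> 'b) \<Rightarrow> 'a \<Rightarrow> 'b"
  where "scaleR_fun c f = (\<lambda>x. c *\<^sub>R f x)"

instance
  by standard
    (auto simp: scaleR_fun_def plus_fun_def fun_eq_iff scaleR_add_right scaleR_add_left)

end

text \<open>Spaces such as L^p depend on a measure and so are not types. A normed space is therefore
  given by a linear subspace V of a type of class \<^class>\<open>real_vector\<close> and a (semi)norm N on V.
  For L^p the elements of V are representatives. A functional bounded with respect to the seminorm
  takes equal values on functions that agree almost everywhere, so the dual of V is the dual of the
  quotient and convergence in V is convergence of the classes.\<close>

definition dual_on :: "'v::real_vector set \<Rightarrow> ('v \<Rightarrow> real) \<Rightarrow> ('v \<Rightarrow> real) set"
  where "dual_on V N = {\<phi>.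
    (\<forall>u\<in>V. \<forall>v\<in>V. \<phi> (u + v) = \<phi> u + \<phi> v) \<and>
    (\<forall>c. \<forall>v\<in>V. \<phi> (c *\<^sub>R v) = c * \<phi> v) \<and>
    (\<exists>C. \<forall>v\<in>V. \<bar>\<phi> v\<bar> \<le> C * N v)}"

definition tendsto_weakly_on ::
    "'v::real_vector set \<Rightarrow> ('v \<Rightarrow> real) \<Rightarrow> ('i \<Rightarrow> 'v) \<Rightarrow> 'v \<Rightarrow> 'i filter \<Rightarrow> bool"
  where "tendsto_weakly_on V N x l F \<longleftrightarrow> (\<forall>\<phi>\<in>dual_on V N. ((\<lambda>i. \<phi> (x i)) \<longlongrightarrow> \<phi> l) F)"

definition tendsto_strongly_on ::
    "'v::real_vector set \<Rightarrow> ('v \<Rightarrow> real) \<Rightarrow> ('i \<Rightarrow> 'v) \<Rightarrow> 'v \<Rightarrow> 'i filter \<Rightarrow> bool"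
  where "tendsto_strongly_on V N x l F \<longleftrightarrow> ((\<lambda>i. N (x i - l)) \<longlongrightarrow> 0) F"

abbreviation tendsto_weakly :: "('i \<Rightarrow> 'v::real_normed_vector) \<Rightarrow> 'v \<Rightarrow> 'i filter \<Rightarrow> bool"
  where "tendsto_weakly \<equiv> tendsto_weakly_on UNIV norm"

definition seq_weakly_lsc :: "('v::real_normed_vector \<Rightarrow> ereal) \<Rightarrow> bool"
  where "seq_weakly_lsc f \<longleftrightarrow>
    (\<forall>x l. tendsto_weakly x l sequentially \<longrightarrow> f l \<le> liminf (\<lambda>n. f (x n)))"

definition reflexive_space :: "'v::real_normed_vector itself \<Rightarrow> bool"
  where "reflexive_space _ \<longleftrightarrow>
    (\<forall>\<Psi> :: ('v \<Rightarrow>\<^sub>L real) \<Rightarrow>\<^sub>L real. \<exists>v. \<forall>\<phi>. blinfun_apply \<Psi> \<phi> = blinfun_apply \<phi> v)"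

text \<open>The library's Borel measurability does not imply strong measurability when the codomain is
  not separable, so Bochner spaces need the latter.\<close>

definition strongly_measurable :: "'a measure \<Rightarrow> ('a \<Rightarrow> 'b::real_normed_vector) \<Rightarrow> bool"
  where "strongly_measurable M f \<longleftrightarrow>
    (\<exists>S. (\<forall>n::nat. simple_function M (S n)) \<and> (\<forall>x\<in>space M. (\<lambda>n. S n x) \<longlonglongrightarrow> f x))"

definition Lp_set :: "real \<Rightarrow> 'a measure \<Rightarrow> ('a \<Rightarrow> 'b::real_normed_vector) set"
  where "Lp_set p M = {f. strongly_measurable M f \<and> integrable M (\<lambda>x. norm (f x) powr p)}"

definition Lp_norm :: "real \<Rightarrow> 'a measure \<Rightarrow> ('a \<Rightarrow> 'b::real_normed_vector) \<Rightarrow> real"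
  where "Lp_norm p M f = (\<integral>x. norm (f x) powr p \<partial>M) powr (1 / p)"

definition smoothing_kernel :: "(real \<Rightarrow> real) \<Rightarrow> bool"
  where "smoothing_kernel \<zeta> \<longleftrightarrow>
    continuous_on UNIV \<zeta> \<and> bounded (range \<zeta>) \<and> (\<forall>x. 0 \<le> \<zeta> x) \<and>
    has_bochner_integral lborel \<zeta> 1 \<and>
    integrable lborel (\<lambda>x. \<zeta> x * \<bar>x\<bar>) \<and>
    ((\<integral>x. \<zeta> x * x \<partial>lborel) \<le> 0 \<or> (LINT x:{..0}|lborel. \<zeta> x * \<bar>x\<bar>) = 0) \<and>
    connected {x. \<zeta> x > 0}"

definition smooth_step :: "(real \<Rightarrow> real) \<Rightarrow> real \<Rightarrow> real \<Rightarrow> real"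
  where "smooth_step \<zeta> \<delta> \<tau> = (LINT \<sigma>:{..\<tau>}|lborel. 1 / \<delta> * \<zeta> (\<sigma> / \<delta>))"

text \<open>Both positive parts take extended real arguments, since g may be infinite. The smoothed one
  is the integral of the nonnegative step function over the reals below x, so at
  plus/minus infinity it has the values infinity and 0 of the ordinary positive part.\<close>

definition smooth_pos_part :: "(real \<Rightarrow> real) \<Rightarrow> real \<Rightarrow> ereal \<Rightarrow> ennreal"
  where "smooth_pos_part \<zeta> \<delta> x =
    (\<integral>\<^sup>+\<tau>. ennreal (smooth_step \<zeta> \<delta> \<tau>) * indicator {\<tau>. ereal \<tau> \<le> x} \<tau> \<partial>lborel)"

definition pos_part :: "ereal \<Rightarrow> ennreal"
  where "pos_part x = e2ennreal (max 0 x)"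

text \<open>The common shape of the two Rockafellians, h being the positive part that is used. The
  integral is that of a nonnegative function and may be infinite.\<close>

definition rockafellian ::
    "(ereal \<Rightarrow> ennreal) \<Rightarrow> ('z \<Rightarrow> ereal) \<Rightarrow> ('u \<Rightarrow> ereal) \<Rightarrow> ('x \<Rightarrow> 'z \<Rightarrow> 'u) \<Rightarrow> real \<Rightarrow>
     'x measure \<Rightarrow> 'x measure \<Rightarrow>
     'z \<times> real \<times> ('x \<Rightarrow> real) \<times> ('x \<Rightarrow> 'x::real_normed_vector) \<Rightarrow> ereal"
  where "rockafellian h f\<^sub>0 g s \<kappa> P \<mu> = (\<lambda>(z, \<gamma>, t, tt).
    if AE \<xi> in \<mu>. t \<xi> = 0 \<and> tt \<xi> = 0
    then f\<^sub>0 z + ereal \<gamma> +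
      ereal \<kappa> * enn2ereal (\<integral>\<^sup>+\<xi>. h (g (s \<xi> z) - ereal \<gamma>) * RN_deriv \<mu> P \<xi> \<partial>\<mu>)
    else \<infinity>)"

definition Phi where "Phi = rockafellian pos_part"

definition Phi_smooth where "Phi_smooth \<zeta> \<delta> = rockafellian (smooth_pos_part \<zeta> \<delta>)"

definition rock_space ::
    "real \<Rightarrow> real \<Rightarrow> 'x measure \<Rightarrow>
     ('z \<times> real \<times> ('x \<Rightarrow> real) \<times> ('x \<Rightarrow> 'x::real_normed_vector)) set"
  where "rock_space q q' \<mu> = UNIV \<times> UNIV \<times> Lp_set q \<mu> \<times> Lp_set q' \<mu>"

definition rock_norm ::
    "real \<Rightarrow> real \<Rightarrow> 'x measure \<Rightarrow>
     'z::real_normed_vector \<times> real \<times> ('x \<Rightarrow> real) \<times> ('x \<Rightarrow> 'x::real_normed_vector) \<Rightarrow> real"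
  where "rock_norm q q' \<mu> = (\<lambda>(z, \<gamma>, t, tt).
    norm z + \<bar>\<gamma>\<bar> + Lp_norm q \<mu> t + Lp_norm q' \<mu> tt)"

text \<open>Mosco convergence on (V, N) of the family \<open>F \<delta>\<close>, \<open>\<delta> > 0\<close>, as \<open>\<delta>\<close> decreases to 0. Since
  the filter \<^term>\<open>at_right (0::real)\<close> has a countable base, quantifying over families indexed by \<open>\<delta>\<close>
  is the same as quantifying over sequences along arbitrary sequences of parameters tending to 0.\<close>

definition mosco_converges_on ::
    "'v::real_vector set \<Rightarrow> ('v \<Rightarrow> real) \<Rightarrow> (real \<Rightarrow> 'v \<Rightarrow> ereal) \<Rightarrow> ('v \<Rightarrow> ereal) \<Rightarrow> bool"
  where "mosco_converges_on V N F G \<longleftrightarrow>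
    (\<forall>x\<in>V. \<exists>y. (\<forall>\<delta>>0. y \<delta> \<in> V) \<and> tendsto_strongly_on V N y x (at_right 0) \<and>
       Limsup (at_right 0) (\<lambda>\<delta>. F \<delta> (y \<delta>)) \<le> G x) \<and>
    (\<forall>x\<in>V. \<forall>y. (\<forall>\<delta>>0. y \<delta> \<in> V) \<longrightarrow> tendsto_weakly_on V N y x (at_right 0) \<longrightarrow>
       G x \<le> Liminf (at_right 0) (\<lambda>\<delta>. F \<delta> (y \<delta>)))"

end

theory Submission
  imports Defs
begin

text \<open>Writing the smoothed positive part as the integral of the distribution function of the
  rescaled kernel, it differs from the positive part by at most \<open>\<delta> m\<close>, where m is the first absolute
  moment of the kernel. Since P has total mass 1, the smoothed functionals are within \<open>\<kappa> m \<delta>\<close> of the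
  limit functional, uniformly, so constant recovery families work and the liminf inequality reduces to
  sequential weak lower semicontinuity of the limit functional. On the set where the perturbations
  vanish this is Fatou's lemma. Elsewhere a bounded functional \<open>u \<mapsto> \<integral>\<^sub>A \<psi> (u x)\<close>, with A of finite measure
  and \<psi> from the Hahn-Banach theorem, shows that nonzero perturbations cannot be weak limits of zero
  ones.\<close>

subsection \<open>Norming functionals\<close>

text \<open>Hahn-Banach by Zorn's lemma on sublinear functionals, ordered pointwise: the minimal ones
  are linear.\<close>

definition sublinear :: "('a::real_vector \<Rightarrow> real) \<Rightarrow> bool"
  where "sublinear p \<longleftrightarrow>
    (\<forall>x y. p (x + y) \<le> p x + p y) \<and> (\<forall>c>0. \<forall>x. p (c *\<^sub>R x) \<le> c * p x)"

lemma sublinearD: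
  assumes "sublinear p"
  shows "p (x + y) \<le> p x + p y" and "0 < c \<Longrightarrow> p (c *\<^sub>R x) \<le> c * p x" and "p 0 = 0"
    and "- p (- x) \<le> p x"
proof -
  have a: "p (x + y) \<le> p x + p y" and h: "0 < c \<Longrightarrow> p (c *\<^sub>R x) \<le> c * p x" for x y c
    using assms unfolding sublinear_def by blast+
  show "p (x + y) \<le> p x + p y" and "0 < c \<Longrightarrow> p (c *\<^sub>R x) \<le> c * p x"
    using a h by blast+
  show z: "p 0 = 0"
    using h[of 2 0] h[of "1/2" 0] by simp
  show "- p (- x) \<le> p x"
    using a[of x "- x"] z by simp
qed

text \<open>Lowering \<open>p\<close> along the ray of \<open>v\<close> is what contradicts
  minimality of a nonlinear \<open>p\<close>: the parameter 1 already pushes the value at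
  \<open>- v\<close> down to \<open>- p v\<close>. The infimum is finite because
  \<open>t * p v = p (t *\<^sub>R v)\<close> is at most
  \<open>p (x + t *\<^sub>R v) + p (- x)\<close>.\<close>

lemma sublinear_directional:
  fixes v :: "'a::real_vector"
  assumes p: "sublinear p"
  defines "q \<equiv> \<lambda>x. INF t\<in>{0..}. p (x + t *\<^sub>R v) - t * p v"
  shows "sublinear q" and "q \<le> p" and "q (- v) \<le> - p v"
proof -
  have hom': "p (t *\<^sub>R x) = t * p x" if "t > 0" for t x
    using sublinearD(2)[OF p, of t x] sublinearD(2)[OF p, of "1/t" "t *\<^sub>R x"] that
    by (auto simp: field_simps)
  have hom0: "p (t *\<^sub>R x) = t * p x" if "t \<ge> 0" for t x
    using hom'[of t x] sublinearD(3)[OF p] that by (cases "t = 0") auto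
  have low: "- p (- x) \<le> p (x + t *\<^sub>R v) - t * p v" if "t \<ge> 0" for t x
    using sublinearD(1)[OF p, of "x + t *\<^sub>R v" "- x"] hom0[OF that, of v] by simp
  have bdd: "bdd_below ((\<lambda>t. p (x + t *\<^sub>R v) - t * p v) ` {0..})" for x
    using low by (intro bdd_belowI2) auto
  have qle: "q x \<le> p (x + t *\<^sub>R v) - t * p v" if "t \<ge> 0" for t x
    unfolding q_def using that by (intro cINF_lower bdd) auto
  have qge: "c \<le> q x" if "\<And>t. t \<ge> 0 \<Longrightarrow> c \<le> p (x + t *\<^sub>R v) - t * p v" for c x
    unfolding q_def using that by (intro cINF_greatest) auto
  show "q \<le> p"
    using qle[of 0] by (simp add: le_fun_def)
  show "q (- v) \<le> - p v"
    using qle[of 1 "- v"] sublinearD(3)[OF p] by simp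
  have "q (x + y) \<le> q x + q y" for x y
  proof -
    have "q (x + y) \<le> (p (x + a *\<^sub>R v) - a * p v) + (p (y + b *\<^sub>R v) - b * p v)"
      if "a \<ge> 0" "b \<ge> 0" for a b
      using qle[of "a + b" "x + y"] that sublinearD(1)[OF p, of "x + a *\<^sub>R v" "y + b *\<^sub>R v"]
      by (simp add: algebra_simps)
    \<comment> \<open>The parameters \<open>a\<close> and \<open>b\<close> are independent, so the
      two infima are taken one after the other: first over \<open>a\<close>, then over
      \<open>b\<close>.\<close>
    then have "q (x + y) - (p (y + b *\<^sub>R v) - b * p v) \<le> q x" if "b \<ge> 0" for b
      using that by (intro qge) (simp add: algebra_simps)
    then have "q (x + y) - q x \<le> q y"
      by (intro qge) (simp add: algebra_simps)
    then show ?thesis by simp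
  qed
  moreover have "q (c *\<^sub>R x) \<le> c * q x" if "c > 0" for c x
  proof -
    have "q (c *\<^sub>R x) / c \<le> q x"
    proof (rule qge)
      \<comment> \<open>The parameter \<open>t\<close> at \<open>x\<close> corresponds to
        \<open>c * t\<close> at the scaled vector, so both infima run over the same
        half-line.\<close>
      fix t :: real assume "t \<ge> 0"
      have "c *\<^sub>R x + (c * t) *\<^sub>R v = c *\<^sub>R (x + t *\<^sub>R v)"
        by (simp add: scaleR_add_right)
      then have "q (c *\<^sub>R x) \<le> c * (p (x + t *\<^sub>R v) - t * p v)"
        using qle[of "c * t" "c *\<^sub>R x"] \<open>t \<ge> 0\<close> that hom'[OF that, of "x + t *\<^sub>R v"]
        by (simp add: right_diff_distrib mult.assoc)
      then show "q (c *\<^sub>R x) / c \<le> p (x + t *\<^sub>R v) - t * p v"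
        using that by (simp add: divide_le_eq mult.commute)
    qed
    then show ?thesis
      using that by (simp add: field_simps)
  qed
  ultimately show "sublinear q"
    by (simp add: sublinear_def)
qed

text \<open>A minimal \<open>p\<close> equals each of its directional lowerings, which gives
  \<open>p (- v) \<le> - p v\<close>; with the reverse inequality \<open>p\<close> is odd. Oddness
  turns subadditivity and the homogeneity inequality, applied to negated vectors, into
  equalities.\<close>

lemma minimal_sublinear_linear:
  assumes p: "sublinear p" and min: "\<And>q. sublinear q \<Longrightarrow> q \<le> p \<Longrightarrow> q = p"
  shows "linear p"
proof -
  have neg: "p (- v) \<le> - p v" for v
    using sublinear_directional(3)[OF p, of v]
      fun_cong[OF min[OF sublinear_directional(1,2)[OF p, of v]], of "- v"] by linarith
  have odd: "p (- v) = - p v" for v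
    using neg[of v] sublinearD(4)[OF p, of v] by linarith
  have add: "p (x + y) = p x + p y" for x y
    using sublinearD(1)[OF p, of x y] sublinearD(1)[OF p, of "x + y" "- y"] odd[of y] by simp
  have pos: "p (c *\<^sub>R x) = c * p x" if "c > 0" for c x
    using sublinearD(2)[OF p that, of x] sublinearD(2)[OF p that, of "- x"] odd[of x]
      odd[of "c *\<^sub>R x"] by simp
  have "p (c *\<^sub>R x) = c * p x" for c x
    using pos[of c x] pos[of "- c" x] odd[of "c *\<^sub>R x"] sublinearD(3)[OF p]
    by (cases "c = 0"; cases "c > 0") auto
  with add show ?thesis
    by (intro linearI) auto
qed

text \<open>A minimal sublinear functional below \<open>p\<^sub>0\<close> is linear, and Zorn's
  lemma provides one because chains have pointwise infima that are again sublinear.\<close>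

lemma sublinear_ge_linear:
  assumes p0: "sublinear p\<^sub>0"
  obtains \<psi> where "linear \<psi>" and "\<And>x. \<psi> x \<le> p\<^sub>0 x"
proof -
  \<comment> \<open>The order is reversed, so the maximal element supplied by Zorn's lemma is
    minimal for the pointwise order.\<close>
  let ?A = "{p. sublinear p \<and> p \<le> p\<^sub>0}" and ?P = "\<lambda>a b :: _ \<Rightarrow> real. b \<le> a"
  have "\<exists>m\<in>?A. \<forall>a\<in>?A. ?P m a \<longrightarrow> a = m"
  proof (rule predicate_Zorn)
    show "partial_order_on ?A (relation_of ?P ?A)"
      by (intro partial_order_on_relation_ofI) auto
  next
    fix C assume C: "C \<in> Chains (relation_of ?P ?A)"
    have inA: "sublinear p" "p \<le> p\<^sub>0" if "p \<in> C" for p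
      using C that by (auto simp: Chains_def relation_of_def)
    have tot: "p \<le> q \<or> q \<le> p" if "p \<in> C" "q \<in> C" for p q
      using C that by (auto simp: Chains_def relation_of_def)
    show "\<exists>u\<in>?A. \<forall>a\<in>C. u \<le> a"
    proof (cases "C = {}")
      case True
      then show ?thesis using p0 by auto
    next
      case False
      \<comment> \<open>The infimum is finite at each point: every member of the chain lies above
        \<open>- p\<^sub>0 (- x)\<close>.\<close>
      define u where "u = (\<lambda>x. INF p\<in>C. p x)"
      have "- p\<^sub>0 (- x) \<le> p x" if "p \<in> C" for p x
        using sublinearD(4)[OF inA(1)[OF that], of x] inA(2)[OF that]
        by (smt (verit) le_funD)
      then have bdd: "bdd_below ((\<lambda>p. p x) ` C)" for x
        by (intro bdd_belowI2)
      have ule: "u x \<le> p x" if "p \<in> C" for p x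
        unfolding u_def using that by (intro cINF_lower bdd)
      have uge: "c \<le> u x" if "\<And>p. p \<in> C \<Longrightarrow> c \<le> p x" for c x
        unfolding u_def using that False by (intro cINF_greatest)
      have "u (x + y) \<le> u x + u y" for x y
      proof -
        \<comment> \<open>Of two members of the chain the smaller one can be used at both
          \<open>x\<close> and \<open>y\<close>, so its own subadditivity suffices.\<close>
        have "u (x + y) \<le> a x + b y" if ab: "a \<in> C" "b \<in> C" for a b
          using tot[OF ab]
        proof
          assume "a \<le> b"
          then show ?thesis
            using ule[OF ab(1), of "x + y"] sublinearD(1)[OF inA(1)[OF ab(1)], of x y]
            by (smt (verit) le_funD)
        next
          assume "b \<le> a"
          then show ?thesis
            using ule[OF ab(2), of "x + y"] sublinearD(1)[OF inA(1)[OF ab(2)], of x y]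
            by (smt (verit) le_funD)
        qed
        then have "u (x + y) - b y \<le> u x" if "b \<in> C" for b
          using that by (intro uge) (simp add: algebra_simps)
        then have "u (x + y) - u x \<le> u y"
          by (intro uge) (simp add: algebra_simps)
        then show ?thesis by simp
      qed
      moreover have "u (c *\<^sub>R x) \<le> c * u x" if "c > 0" for c x
      proof -
        have "u (c *\<^sub>R x) / c \<le> u x"
        proof (rule uge)
          fix p assume "p \<in> C"
          then show "u (c *\<^sub>R x) / c \<le> p x"
            using ule[of p "c *\<^sub>R x"] sublinearD(2)[OF inA(1) that, of p x] that
            by (simp add: field_simps)
        qed
        then show ?thesis
          using that by (simp add: field_simps)
      qed
      ultimately have "sublinear u"
        by (simp add: sublinear_def)
      moreover have "u \<le> p\<^sub>0"
        using False ule inA(2) by (meson all_not_in_conv le_funD le_funI order_trans)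
      ultimately show ?thesis
        using ule by (auto simp: le_fun_def)
    qed
  qed
  then obtain m where m: "sublinear m" "m \<le> p\<^sub>0"
    and max: "\<forall>a\<in>?A. a \<le> m \<longrightarrow> a = m"
    by blast
  \<comment> \<open>Anything below \<open>m\<close> is below \<open>p\<^sub>0\<close>, so minimality
    within \<open>?A\<close> is minimality among all sublinear functionals.\<close>
  have min: "a = m" if "sublinear a" "a \<le> m" for a
    using max that order_trans[OF that(2) m(2)] by blast
  from m(2) show thesis
    by (intro that[OF minimal_sublinear_linear[OF m(1) min]]) (auto simp: le_fun_def)
qed

text \<open>The linear minorant is taken not of the norm but of the norm lowered along
  \<open>v\<close>. This forces \<open>\<psi> (- v) \<le> - norm v\<close>, hence equality at
  \<open>v\<close>, while the norm still dominates.\<close>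

lemma norming_functional:
  fixes v :: "'a::real_normed_vector"
  obtains \<psi> where "linear \<psi>" and "\<And>x. \<bar>\<psi> x\<bar> \<le> norm x" and "\<psi> v = norm v"
proof -
  have sub: "sublinear (norm :: 'a \<Rightarrow> real)"
    by (simp add: sublinear_def norm_triangle_ineq)
  note dir = sublinear_directional[OF sub, of v]
  obtain \<psi> where lin: "linear \<psi>"
    and le: "\<And>x. \<psi> x \<le> (INF t\<in>{0..}. norm (x + t *\<^sub>R v) - t * norm v)"
    using sublinear_ge_linear[OF dir(1)] by blast
  have neg: "\<psi> (- x) = - \<psi> x" for x
    by (rule linear_neg[OF lin])
  have ub: "\<psi> x \<le> norm x" for x
    by (rule order_trans[OF le le_funD[OF dir(2)]])
  have "\<psi> (- v) \<le> - norm v"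
    by (rule order_trans[OF le dir(3)])
  then have "\<psi> v = norm v"
    using ub[of v] neg[of v] by linarith
  moreover have "\<bar>\<psi> x\<bar> \<le> norm x" for x
    using ub[of x] ub[of "- x"] neg[of x] unfolding norm_minus_cancel by linarith
  ultimately show thesis
    by (intro that[OF lin])
qed

subsection \<open>Separating functionals on Lebesgue spaces\<close>

lemma strongly_measurable_ball:
  assumes "strongly_measurable M f"
  shows "{x \<in> space M. norm (f x - v) < e} \<in> sets M"
proof -
  from assms obtain S where S: "\<And>n::nat. simple_function M (S n)"
    "\<And>x. x \<in> space M \<Longrightarrow> (\<lambda>n. S n x) \<longlonglongrightarrow> f x"
    by (auto simp: strongly_measurable_def)
  have "(\<lambda>x. norm (f x - v)) \<in> borel_measurable M"
  proof (rule borel_measurable_LIMSEQ_real[where u = "\<lambda>n x. norm (S n x - v)"])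
    show "(\<lambda>n. norm (S n x - v)) \<longlonglongrightarrow> norm (f x - v)" if "x \<in> space M" for x
      using S(2)[OF that] by (intro tendsto_intros)
    show "(\<lambda>x. norm (S n x - v)) \<in> borel_measurable M" for n
      by (rule borel_measurable_simple_function, rule simple_function_compose2[where g = "\<lambda>_. v"])
        (auto intro: S)
  qed
  then show ?thesis by measurable
qed

lemma strongly_measurable_linear_comp:
  fixes \<psi> :: "'b::real_normed_vector \<Rightarrow> real"
  assumes "strongly_measurable M f" and "bounded_linear \<psi>"
  shows "(\<lambda>x. \<psi> (f x)) \<in> borel_measurable M"
proof -
  from assms obtain S where S: "\<And>n::nat. simple_function M (S n)"
    "\<And>x. x \<in> space M \<Longrightarrow> (\<lambda>n. S n x) \<longlonglongrightarrow> f x"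
    by (auto simp: strongly_measurable_def)
  show ?thesis
  proof (rule borel_measurable_LIMSEQ_real[where u = "\<lambda>n x. \<psi> (S n x)"])
    show "(\<lambda>n. \<psi> (S n x)) \<longlonglongrightarrow> \<psi> (f x)" if "x \<in> space M" for x
      using S(2)[OF that] by (intro bounded_linear.tendsto[OF assms(2)])
    show "(\<lambda>x. \<psi> (S n x)) \<in> borel_measurable M" for n
      by (rule borel_measurable_simple_function) (rule simple_function_compose1[OF S(1)])
  qed
qed

text \<open>The approximating simple functions have only countably many values in all, and the balls
  around these values cover the set where \<open>f\<close> is nonzero. If all the balls were null,
  so would be that set. The radius \<open>norm v / 2\<close> ensures that a functional norming
  \<open>v\<close> is positive on the values of \<open>f\<close> in the ball.\<close>

lemma strongly_measurable_concentrates: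
  assumes f: "strongly_measurable M f" and nz: "\<not> (AE x in M. f x = 0)"
  obtains v where "{x \<in> space M. norm (f x - v) < norm v / 2} \<notin> null_sets M"
proof (rule ccontr)
  assume neg: "\<not> thesis"
  from f obtain S where S: "\<And>n::nat. simple_function M (S n)"
    "\<And>x. x \<in> space M \<Longrightarrow> (\<lambda>n. S n x) \<longlonglongrightarrow> f x"
    by (auto simp: strongly_measurable_def)
  define D where "D = (\<Union>n. S n ` space M)"
  let ?B = "\<lambda>v. {x \<in> space M. norm (f x - v) < norm v / 2}"
  have "countable D"
    unfolding D_def using S(1) by (auto simp: simple_function_def intro: countable_finite)
  then have "(\<Union>v\<in>D. ?B v) \<in> null_sets M"
    using neg that by (intro null_sets_UN') blast+
  moreover have "{x \<in> space M. f x \<noteq> 0} \<subseteq> (\<Union>v\<in>D. ?B v)"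
  proof safe
    fix x assume x: "x \<in> space M" "f x \<noteq> 0"
    then have "\<forall>\<^sub>F n in sequentially. dist (S n x) (f x) < norm (f x) / 3"
      using S(2) by (intro tendstoD) auto
    then obtain n where n: "dist (S n x) (f x) < norm (f x) / 3"
      by (auto simp: eventually_sequentially)
    \<comment> \<open>A distance below a third of \<open>norm (f x)\<close> leaves
      \<open>norm (S n x)\<close> above two thirds of it, and half of that still exceeds the
      distance.\<close>
    then have "norm (f x - S n x) < norm (S n x) / 2"
      using norm_triangle_ineq[of "f x - S n x" "S n x"] by (simp add: dist_norm norm_minus_commute)
    with x show "x \<in> (\<Union>v\<in>D. ?B v)"
      by (auto simp: D_def)
  qed
  ultimately have "AE x in M. f x = 0"
    by (intro AE_I') auto
  with nz show False by contradiction
qed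

lemma Lp_norm_nonneg: "0 \<le> Lp_norm p M f"
  by (simp add: Lp_norm_def)

lemma Lp_norm_eq_0: "AE x in M. f x = 0 \<Longrightarrow> Lp_norm p M f = 0"
  unfolding Lp_norm_def
  by (subst integral_eq_zero_AE) (auto elim!: eventually_mono)

text \<open>With \<open>b = a / c\<close> this is \<open>b \<le> 1 + b powr p\<close>: the first
  summand suffices for \<open>b \<le> 1\<close>, the second for larger \<open>b\<close>.\<close>

lemma le_add_powr:
  fixes a c p :: real
  assumes "0 \<le> a" "0 < c" "1 \<le> p"
  shows "a \<le> c + c * (a / c) powr p"
proof -
  define b where "b = a / c"
  have "b \<le> 1 + b powr p"
  proof (cases "b \<le> 1")
    case False
    then have "b powr 1 \<le> b powr p"
      using assms by (intro powr_mono) auto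
    with False show ?thesis by simp
  qed (use powr_ge_zero[of b p] in linarith)
  then have "c * b \<le> c * (1 + b powr p)"
    using assms by (intro mult_left_mono) auto
  with assms show ?thesis
    by (simp add: b_def algebra_simps)
qed

text \<open>In place of the Hoelder inequality, integrate \<open>a \<le> c + c (a / c)\<^sup>p\<close> with \<open>a = norm (u x)\<close> and c the norm
  of u.\<close>

lemma Lp_integrable_on_finite:
  assumes u: "u \<in> Lp_set p M" and p: "1 \<le> p"
    and A: "A \<in> sets M" "emeasure M A < \<infinity>" and \<psi>: "bounded_linear \<psi>" "\<And>x. \<bar>\<psi> x\<bar> \<le> norm x"
  shows "set_integrable M A (\<lambda>x. \<psi> (u x) :: real)"
    and "\<bar>LINT x:A|M. \<psi> (u x)\<bar> \<le> (measure M A + 1) * Lp_norm p M u"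
proof -
  have sm: "strongly_measurable M u" and int: "integrable M (\<lambda>x. norm (u x) powr p)"
    using u by (auto simp: Lp_set_def)
  have meas [measurable]: "(\<lambda>x. \<psi> (u x)) \<in> borel_measurable M"
    by (rule strongly_measurable_linear_comp[OF sm \<psi>(1)])
  note A(1) [measurable]
  have pw: "norm (indicator A x *\<^sub>R \<psi> (u x)) \<le> c * indicator A x + c * (norm (u x) powr p / c powr p)"
    if "c > 0" for c x
    using le_add_powr[OF norm_ge_zero[of "u x"] that p] \<psi>(2)[of "u x"] that
    by (auto simp: indicator_def powr_divide)
  have ii: "integrable M (\<lambda>x. c * indicator A x + c * (norm (u x) powr p / c powr p))" for c
    using int A by (intro Bochner_Integration.integrable_add) auto
  show si: "set_integrable M A (\<lambda>x. \<psi> (u x) :: real)"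
    unfolding set_integrable_def
    by (rule Bochner_Integration.integrable_bound[OF ii[of 1]])
      (use pw[of 1] in \<open>auto intro!: AE_I2 order_trans[OF _ abs_ge_self]\<close>)
  define I where "I = (\<integral>x. norm (u x) powr p \<partial>M)"
  have I0: "I \<ge> 0" by (simp add: I_def)
  have bd: "\<bar>LINT x:A|M. \<psi> (u x)\<bar> \<le> c * measure M A + c * (I / c powr p)" if "c > 0" for c
  proof -
    have "norm (\<integral>x. indicator A x *\<^sub>R \<psi> (u x) \<partial>M)
        \<le> (\<integral>x. c * indicator A x + c * (norm (u x) powr p / c powr p) \<partial>M)"
      by (rule order_trans[OF integral_norm_bound integral_mono])
        (use si pw[OF that] ii[of c] in \<open>auto simp: set_integrable_def\<close>)
    also have "\<dots> = c * measure M A + c * (I / c powr p)"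
      using int A by (subst Bochner_Integration.integral_add)
         (auto simp: I_def measure_def[symmetric])
    finally show ?thesis
      by (simp add: set_lebesgue_integral_def)
  qed
  show "\<bar>LINT x:A|M. \<psi> (u x)\<bar> \<le> (measure M A + 1) * Lp_norm p M u"
  proof (cases "I = 0")
    case True
    then have "AE x in M. norm (u x) powr p = 0"
      using int by (subst (asm) I_def, subst (asm) integral_nonneg_eq_0_iff_AE) auto
    then have "AE x in M. u x = 0"
      by (auto elim!: eventually_mono)
    then have "(LINT x:A|M. \<psi> (u x)) = 0"
      unfolding set_lebesgue_integral_def
      by (intro integral_eq_zero_AE) (auto elim!: eventually_mono simp: linear_0 bounded_linear.linear[OF \<psi>(1)])
    then show ?thesis
      by (simp add: Lp_norm_nonneg)
  next
    case False
    then have pos: "I > 0" using I0 by simp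
    \<comment> \<open>For this \<open>c\<close> the quotient \<open>I / c powr p\<close> is 1, so
      the bound becomes \<open>c\<close> times \<open>measure M A + 1\<close>. It has to be
      positive, hence the separate case \<open>I = 0\<close>.\<close>
    define c where "c = I powr (1 / p)"
    have "c > 0" and "c powr p = I"
      using pos p by (auto simp: c_def powr_powr)
    with bd[of c] pos show ?thesis
      by (simp add: c_def Lp_norm_def I_def[symmetric] algebra_simps)
  qed
qed

text \<open>On a ball around \<open>v\<close> of radius \<open>norm v / 2\<close> a functional
  \<open>\<psi>\<close> norming \<open>v\<close> is positive: \<open>\<psi> (f x)\<close> differs
  from \<open>norm v\<close> by less than half of it. Integrating over a part \<open>A\<close> of
  the preimage with positive finite measure gives a nonzero value, and finiteness of the measure
  makes the integral bounded by the norm.\<close>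

lemma Lp_separating_functional:
  fixes f :: "'a \<Rightarrow> 'b::real_normed_vector"
  assumes "sigma_finite_measure M" and p: "1 \<le> p"
    and f: "f \<in> Lp_set p M" and nz: "\<not> (AE x in M. f x = 0)"
  obtains \<phi> where "\<phi> \<in> dual_on (Lp_set p M) (Lp_norm p M)" and "\<phi> f \<noteq> 0"
proof -
  interpret sigma_finite_measure M by fact
  have sm: "strongly_measurable M f" using f by (simp add: Lp_set_def)
  obtain v where v: "{x \<in> space M. norm (f x - v) < norm v / 2} \<notin> null_sets M"
    (is "?B \<notin> _") by (rule strongly_measurable_concentrates[OF sm nz])
  have B [measurable]: "?B \<in> sets M"
    by (rule strongly_measurable_ball[OF sm])
  \<comment> \<open>A countable cover by sets of finite measure must meet the non-null preimage in a
    non-null piece.\<close>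
  obtain A where A: "A \<in> sets M" "A \<subseteq> ?B" "emeasure M A < \<infinity>" "emeasure M A > 0"
  proof -
    obtain F :: "nat \<Rightarrow> _" where F: "range F \<subseteq> sets M" "(\<Union>i. F i) = space M"
      "\<And>i. emeasure M (F i) \<noteq> \<infinity>"
      by (rule sigma_finite) blast
    have "\<exists>i. ?B \<inter> F i \<notin> null_sets M"
    proof (rule ccontr)
      assume "\<nexists>i. ?B \<inter> F i \<notin> null_sets M"
      then have "(\<Union>i. ?B \<inter> F i) \<in> null_sets M"
        by (intro null_sets_UN) auto
      also have "(\<Union>i. ?B \<inter> F i) = ?B"
        using F(2) by auto
      finally show False using v by simp
    qed
    then obtain i where i: "?B \<inter> F i \<notin> null_sets M" ..
    have m: "?B \<inter> F i \<in> sets M" using F(1) B by auto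
    moreover have "emeasure M (?B \<inter> F i) \<le> emeasure M (F i)"
      using F(1) by (intro emeasure_mono) auto
    moreover have "emeasure M (?B \<inter> F i) > 0"
      using i m by (auto simp: null_sets_def zero_less_iff_neq_zero)
    ultimately show thesis
      using F(3)[of i] by (intro that[of "?B \<inter> F i"]) (auto simp: less_top[symmetric] top_unique)
  qed
  obtain \<psi> where \<psi>: "linear \<psi>" "\<And>x. \<bar>\<psi> x\<bar> \<le> norm x" "\<psi> v = norm v"
    using norming_functional[of v] by blast
  have bl: "bounded_linear \<psi>"
    using \<psi>(1,2) by (intro bounded_linear.intro bounded_linear_axioms.intro) (auto intro!: exI[of _ 1])
  note int = Lp_integrable_on_finite[OF _ p A(1,3) bl \<psi>(2)]
  define \<phi> where "\<phi> = (\<lambda>u. LINT x:A|M. \<psi> (u x))"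
  show thesis
  proof (rule that)
    show "\<phi> \<in> dual_on (Lp_set p M) (Lp_norm p M)"
      unfolding dual_on_def \<phi>_def using int
      by (auto simp: linear_add[OF \<psi>(1)] linear_scale[OF \<psi>(1)] scaleR_fun_def)
    have pos: "\<psi> (f x) > 0" if "x \<in> A" for x
    proof -
      have "\<psi> (f x) = norm v + \<psi> (f x - v)"
        using \<psi>(1,3) by (simp add: linear_diff)
      then show ?thesis
        using \<psi>(2)[of "f x - v"] that A(2) by auto
    qed
    show "\<phi> f \<noteq> 0"
    proof
      assume "\<phi> f = 0"
      then have "AE x in M. indicator A x *\<^sub>R \<psi> (f x) = 0"
        unfolding \<phi>_def set_lebesgue_integral_def using int(1)[OF f] pos
        by (subst (asm) integral_nonneg_eq_0_iff_AE)
          (auto simp: set_integrable_def indicator_def less_imp_le intro!: AE_I2)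
      then have "AE x in M. x \<notin> A"
        by eventually_elim (use pos in \<open>force simp: indicator_def\<close>)
      then show False
        using A(1,4) by (simp add: AE_iff_null_sets[symmetric] null_sets_def)
    qed
  qed
qed

subsection \<open>Smoothing of the positive part\<close>

text \<open>This is the form of \<open>smooth_pos_part\<close> with the Heaviside function in place
  of the smooth step, so that the two positive parts can be compared under one integral, infinite
  arguments included.\<close>

lemma pos_part_eq_nn_integral:
  "pos_part x = (\<integral>\<^sup>+\<tau>. indicator {0..} \<tau> * indicator {\<tau>. ereal \<tau> \<le> x} \<tau> \<partial>lborel)"
proof (cases x)
  case (real r)
  have "(\<integral>\<^sup>+\<tau>. indicator {0..} \<tau> * indicator {\<tau>. ereal \<tau> \<le> x} \<tau> \<partial>lborel) =
      (\<integral>\<^sup>+\<tau>. indicator {0..r} \<tau> \<partial>lborel)"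
    unfolding real by (intro nn_integral_cong) (auto simp: indicator_def)
  also have "\<dots> = pos_part x"
    unfolding real by (cases "0 \<le> r") (auto simp: pos_part_def max_def e2ennreal_ereal)
  finally show ?thesis
    by (rule sym)
next
  case PInf
  have "emeasure lborel {0::real..} = top"
  proof (rule ccontr)
    assume "emeasure lborel {0::real..} \<noteq> top"
    then obtain r where r: "emeasure lborel {0::real..} = ennreal r" "r \<ge> 0"
      by (cases "emeasure lborel {0::real..}") auto
    have "emeasure lborel {0..r+1} \<le> emeasure lborel {0::real..}"
      by (intro emeasure_mono) auto
    then show False
      using r by simp
  qed
  then show ?thesis
    unfolding PInf by (simp add: pos_part_def)
next
  case MInf
  show ?thesis unfolding MInf by (simp add: pos_part_def e2ennreal_neg)
qed

text \<open>Both bounds below have the same error term, the area between the distribution function of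
  the density k and the Heaviside function.\<close>

context
  fixes k :: "real \<Rightarrow> ennreal" and F :: "real \<Rightarrow> ennreal"
  assumes k [measurable]: "k \<in> borel_measurable borel"
    and k1: "(\<integral>\<^sup>+s. k s \<partial>lborel) = 1"
    and F: "\<And>\<tau>. F \<tau> = (\<integral>\<^sup>+s. k s * indicator {..\<tau>} s \<partial>lborel)"
begin

text \<open>The absolute difference of the step at \<open>s\<close> and the step at 0, evaluated at
  \<open>\<tau>\<close>; it is 1 exactly if \<open>\<tau>\<close> lies between the two
  jumps.\<close>

private abbreviation gap :: "real \<Rightarrow> real \<Rightarrow> ennreal" where
  "gap \<tau> s \<equiv> (if s \<le> \<tau> \<and> \<tau> < 0 \<or> 0 \<le> \<tau> \<and> \<tau> < s then 1 else 0)"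

private definition err :: "real \<Rightarrow> ennreal" where
  "err \<tau> = (\<integral>\<^sup>+s. k s * gap \<tau> s \<partial>lborel)"

lemma cdf_measurable: "F \<in> borel_measurable borel"
proof -
  \<comment> \<open>Written with a conditional, the integrand is visibly measurable in both
    variables jointly, as needed for an integral with a parameter.\<close>
  have "(\<lambda>\<tau>. \<integral>\<^sup>+s. k s * (if s \<le> \<tau> then 1 else 0) \<partial>lborel) \<in> borel_measurable borel"
    by measurable
  also have "(\<lambda>\<tau>. \<integral>\<^sup>+s. k s * (if s \<le> \<tau> then 1 else 0) \<partial>lborel) = F"
    unfolding F by (intro ext nn_integral_cong) auto
  finally show ?thesis .
qed

private lemma err_measurable [measurable]: "err \<in> borel_measurable borel"
  unfolding err_def by measurable

text \<open>By Tonelli the order of integration may be exchanged, and for fixed \<open>s\<close> the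
  points \<open>\<tau>\<close> between 0 and \<open>s\<close> form an interval of length
  \<open>\<bar>s\<bar>\<close>.\<close>

private lemma err_integral: "(\<integral>\<^sup>+\<tau>. err \<tau> \<partial>lborel) = (\<integral>\<^sup>+s. k s * ennreal \<bar>s\<bar> \<partial>lborel)"
proof -
  have "(\<integral>\<^sup>+\<tau>. err \<tau> \<partial>lborel) = (\<integral>\<^sup>+s. (\<integral>\<^sup>+\<tau>. k s * gap \<tau> s \<partial>lborel) \<partial>lborel)"
    unfolding err_def by (rule lborel_pair.Fubini') measurable
  also have "\<dots> = (\<integral>\<^sup>+s. k s * ennreal \<bar>s\<bar> \<partial>lborel)"
  proof (intro nn_integral_cong)
    fix s :: real
    have "(\<integral>\<^sup>+\<tau>. gap \<tau> s \<partial>lborel) = (\<integral>\<^sup>+\<tau>. indicator (if s < 0 then {s..<0} else {0..<s}) \<tau> \<partial>lborel)"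
      by (intro nn_integral_cong) (auto simp: indicator_def)
    also have "\<dots> = ennreal \<bar>s\<bar>"
      by (cases "s < 0") auto
    finally show "(\<integral>\<^sup>+\<tau>. k s * gap \<tau> s \<partial>lborel) = k s * ennreal \<bar>s\<bar>"
      by (subst nn_integral_cmult) auto
  qed
  finally show ?thesis .
qed

text \<open>Since \<open>k\<close> has mass 1, the Heaviside value is itself an integral against
  \<open>k\<close>, and the comparison holds for each \<open>s\<close> separately. The same reason
  gives the reverse bound in \<open>heaviside_le\<close>.\<close>

private lemma cdf_le: "F \<tau> \<le> indicator {0..} \<tau> + err \<tau>"
proof -
  have "F \<tau> \<le> (\<integral>\<^sup>+s. k s * indicator {0..} \<tau> + k s * gap \<tau> s \<partial>lborel)"
    unfolding F by (intro nn_integral_mono) (auto simp: indicator_def)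
  also have "\<dots> = indicator {0..} \<tau> + err \<tau>"
    by (simp add: nn_integral_add nn_integral_multc k1 err_def)
  finally show ?thesis .
qed

private lemma heaviside_le: "indicator {0..} \<tau> \<le> F \<tau> + err \<tau>"
proof -
  have "indicator {0..} \<tau> = (\<integral>\<^sup>+s. k s * indicator {0..} \<tau> \<partial>lborel)"
    by (simp add: nn_integral_multc k1)
  also have "\<dots> \<le> (\<integral>\<^sup>+s. k s * indicator {..\<tau>} s + k s * gap \<tau> s \<partial>lborel)"
    by (intro nn_integral_mono) (auto simp: indicator_def)
  also have "\<dots> = F \<tau> + err \<tau>"
    by (simp add: nn_integral_add F err_def)
  finally show ?thesis .
qed

text \<open>The error is integrated over the whole line instead of the part below \<open>x\<close>,
  which makes the bound uniform in \<open>x\<close>. Both this bound and its converse are stated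
  additively because the values can be infinite.\<close>

lemma cdf_integral_le_pos_part:
  "(\<integral>\<^sup>+\<tau>. F \<tau> * indicator {\<tau>. ereal \<tau> \<le> x} \<tau> \<partial>lborel) \<le>
    pos_part x + (\<integral>\<^sup>+s. k s * ennreal \<bar>s\<bar> \<partial>lborel)"
proof -
  note cdf_measurable [measurable]
  have "(\<integral>\<^sup>+\<tau>. F \<tau> * indicator {\<tau>. ereal \<tau> \<le> x} \<tau> \<partial>lborel) \<le>
      (\<integral>\<^sup>+\<tau>. indicator {0..} \<tau> * indicator {\<tau>. ereal \<tau> \<le> x} \<tau> + err \<tau> \<partial>lborel)"
    using cdf_le by (intro nn_integral_mono) (auto simp: indicator_def)
  also have "\<dots> = pos_part x + (\<integral>\<^sup>+s. k s * ennreal \<bar>s\<bar> \<partial>lborel)"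
    by (simp add: nn_integral_add err_integral pos_part_eq_nn_integral)
  finally show ?thesis .
qed

lemma pos_part_le_cdf_integral:
  "pos_part x \<le> (\<integral>\<^sup>+\<tau>. F \<tau> * indicator {\<tau>. ereal \<tau> \<le> x} \<tau> \<partial>lborel) +
    (\<integral>\<^sup>+s. k s * ennreal \<bar>s\<bar> \<partial>lborel)"
proof -
  note cdf_measurable [measurable]
  have "pos_part x \<le> (\<integral>\<^sup>+\<tau>. F \<tau> * indicator {\<tau>. ereal \<tau> \<le> x} \<tau> + err \<tau> \<partial>lborel)"
    unfolding pos_part_eq_nn_integral
    using heaviside_le by (intro nn_integral_mono) (auto simp: indicator_def)
  also have "\<dots> = (\<integral>\<^sup>+\<tau>. F \<tau> * indicator {\<tau>. ereal \<tau> \<le> x} \<tau> \<partial>lborel) +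
    (\<integral>\<^sup>+s. k s * ennreal \<bar>s\<bar> \<partial>lborel)"
    by (simp add: nn_integral_add err_integral)
  finally show ?thesis .
qed

end

text \<open>The preceding bounds are applied to the rescaled kernel, whose first absolute moment is
  \<open>\<delta> * m\<close> by substitution.\<close>

lemma
  assumes \<zeta>: "smoothing_kernel \<zeta>" and \<delta>: "0 < \<delta>"
  defines "m \<equiv> \<integral>x. \<zeta> x * \<bar>x\<bar> \<partial>lborel"
  shows smooth_pos_part_le: "smooth_pos_part \<zeta> \<delta> x \<le> pos_part x + ennreal (\<delta> * m)"
    and pos_part_le: "pos_part x \<le> smooth_pos_part \<zeta> \<delta> x + ennreal (\<delta> * m)"
proof -
  define k where "k = (\<lambda>s. ennreal (1 / \<delta> * \<zeta> (s / \<delta>)))"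
  have nonneg: "\<zeta> s \<ge> 0" for s
    using \<zeta> by (simp add: smoothing_kernel_def)
  have [measurable]: "\<zeta> \<in> borel_measurable borel"
    using \<zeta> by (auto simp: smoothing_kernel_def intro: borel_measurable_continuous_onI)
  have k_meas [measurable]: "k \<in> borel_measurable borel"
    unfolding k_def by measurable
  \<comment> \<open>The substitution by the factor \<open>\<delta>\<close> cancels
    \<open>1 / \<delta>\<close>. The constant 1 for \<open>f\<close> gives the total mass, the
    absolute value gives the moment.\<close>
  have scale: "(\<integral>\<^sup>+s. k s * ennreal (f s) \<partial>lborel) = (\<integral>\<^sup>+s. ennreal (\<zeta> s * f (\<delta> * s)) \<partial>lborel)"
    if [measurable]: "f \<in> borel_measurable borel" and "\<And>s. f s \<ge> 0" for f
    using \<delta> nonneg that(2)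
    by (subst nn_integral_real_affine[where c = \<delta> and t = 0])
      (auto simp: k_def ennreal_mult[symmetric] nn_integral_cmult[symmetric] mult.assoc[symmetric])
  have int: "integrable lborel \<zeta>" and "(\<integral>s. \<zeta> s \<partial>lborel) = 1"
    using \<zeta> by (auto simp: smoothing_kernel_def has_bochner_integral_iff)
  then have "(\<integral>\<^sup>+s. ennreal (\<zeta> s) \<partial>lborel) = 1"
    using nonneg by (subst nn_integral_eq_integral) auto
  then have k1: "(\<integral>\<^sup>+s. k s \<partial>lborel) = 1"
    using scale[of "\<lambda>_. 1"] by simp
  have mom: "(\<integral>\<^sup>+s. k s * ennreal \<bar>s\<bar> \<partial>lborel) = ennreal (\<delta> * m)"
  proof -
    have "integrable lborel (\<lambda>s. \<delta> * (\<zeta> s * \<bar>s\<bar>))"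
      using \<zeta> by (simp add: smoothing_kernel_def)
    then have "(\<integral>\<^sup>+s. ennreal (\<delta> * (\<zeta> s * \<bar>s\<bar>)) \<partial>lborel) = ennreal (\<delta> * m)"
      using nonneg \<delta> by (subst nn_integral_eq_integral) (auto simp: m_def)
    then show ?thesis
      using scale[of abs] \<delta> by (simp add: abs_mult mult_ac)
  qed
  \<comment> \<open>The real-valued integral in \<open>smooth_step\<close> agrees with the
    nonnegative one, because the finite mass of \<open>k\<close> makes the rescaled kernel
    integrable.\<close>
  have F: "ennreal (smooth_step \<zeta> \<delta> \<tau>) = (\<integral>\<^sup>+s. k s * indicator {..\<tau>} s \<partial>lborel)" for \<tau>
  proof -
    have "integrable lborel (\<lambda>s. 1 / \<delta> * \<zeta> (s / \<delta>))"
      using k1 nonneg \<delta> by (intro integrableI_nonneg) (auto simp: k_def)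
    then have "integrable lborel (\<lambda>s. indicator {..\<tau>} s *\<^sub>R (1 / \<delta> * \<zeta> (s / \<delta>)))"
      by (intro integrable_mult_indicator) auto
    then have "ennreal (smooth_step \<zeta> \<delta> \<tau>) =
        (\<integral>\<^sup>+s. ennreal (indicator {..\<tau>} s *\<^sub>R (1 / \<delta> * \<zeta> (s / \<delta>))) \<partial>lborel)"
      unfolding smooth_step_def set_lebesgue_integral_def
      using nonneg \<delta> by (intro nn_integral_eq_integral[symmetric]) auto
    also have "\<dots> = (\<integral>\<^sup>+s. k s * indicator {..\<tau>} s \<partial>lborel)"
      by (intro nn_integral_cong) (auto simp: k_def indicator_def)
    finally show ?thesis .
  qed
  show "smooth_pos_part \<zeta> \<delta> x \<le> pos_part x + ennreal (\<delta> * m)"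
    and "pos_part x \<le> smooth_pos_part \<zeta> \<delta> x + ennreal (\<delta> * m)"
    unfolding smooth_pos_part_def mom[symmetric]
    by (rule cdf_integral_le_pos_part pos_part_le_cdf_integral, fact k_meas, fact k1, fact F)+
qed

subsection \<open>Mosco convergence\<close>

text \<open>An error \<open>C * \<delta>\<close> that is uniform in the point vanishes in the limit,
  so it affects neither the limsup along a constant family nor the liminf along a weakly convergent
  one.\<close>

lemma mosco_converges_on_if_uniform:
  assumes lsc: "\<And>x y. x \<in> V \<Longrightarrow> (\<And>n. y n \<in> V) \<Longrightarrow> tendsto_weakly_on V N y x sequentially \<Longrightarrow>
      G x \<le> liminf (\<lambda>n. G (y n))"
    and N0: "N 0 = 0"
    and upper: "\<And>\<delta> v. \<delta> > 0 \<Longrightarrow> F \<delta> v \<le> G v + ereal (C * \<delta>)"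
    and lower: "\<And>\<delta> v. \<delta> > 0 \<Longrightarrow> G v \<le> F \<delta> v + ereal (C * \<delta>)"
  shows "mosco_converges_on V N F G"
  unfolding mosco_converges_on_def
proof (intro conjI ballI allI impI)
  fix x assume x: "x \<in> V"
  have "((\<lambda>\<delta>. C * \<delta>) \<longlongrightarrow> C * 0) (at_right 0)"
    by (intro tendsto_intros)
  then have "((\<lambda>\<delta>. G x + ereal (C * \<delta>)) \<longlongrightarrow> G x + ereal (C * 0)) (at_right 0)"
    by (intro tendsto_add_ereal_general1) auto
  then have "Limsup (at_right 0) (\<lambda>\<delta>. G x + ereal (C * \<delta>)) = G x"
    by (subst lim_imp_Limsup) auto
  moreover have "Limsup (at_right 0) (\<lambda>\<delta>. F \<delta> x) \<le> Limsup (at_right 0) (\<lambda>\<delta>. G x + ereal (C * \<delta>))"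
    using upper by (intro Limsup_mono) (auto simp: eventually_at_right_field intro: exI[of _ 1])
  ultimately have "Limsup (at_right 0) (\<lambda>\<delta>. F \<delta> x) \<le> G x"
    by simp
  then show "\<exists>y. (\<forall>\<delta>>0. y \<delta> \<in> V) \<and> tendsto_strongly_on V N y x (at_right 0) \<and>
      Limsup (at_right 0) (\<lambda>\<delta>. F \<delta> (y \<delta>)) \<le> G x"
    using x N0 by (intro exI[of _ "\<lambda>_. x"]) (auto simp: tendsto_strongly_on_def)
next
  fix x y assume x: "x \<in> V" and y: "\<forall>\<delta>>0. y \<delta> \<in> V"
    and weak: "tendsto_weakly_on V N y x (at_right (0::real))"
  show "G x \<le> Liminf (at_right 0) (\<lambda>\<delta>. F \<delta> (y \<delta>))"
    unfolding le_Liminf_iff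
  proof (intro allI impI)
    fix c assume c: "c < G x"
    show "\<forall>\<^sub>F \<delta> in at_right 0. c < F \<delta> (y \<delta>)"
    proof (rule sequentially_imp_eventually_at_right[OF zero_less_one])
      \<comment> \<open>Semicontinuity of \<open>G\<close> is known along sequences only. An
        eventual property to the right of 0 may be tested along sequences \<open>d\<close> tending
        to 0, which makes it applicable.\<close>
      fix d :: "nat \<Rightarrow> real" assume d: "\<And>n. 0 < d n" "d \<longlonglongrightarrow> 0"
      then have lim: "filterlim d (at_right 0) sequentially"
        by (auto simp: filterlim_at less_imp_neq[symmetric])
      have "tendsto_weakly_on V N (\<lambda>n. y (d n)) x sequentially"
        using weak filterlim_compose[OF _ lim] by (auto simp: tendsto_weakly_on_def)
      then have "G x \<le> liminf (\<lambda>n. G (y (d n)))"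
        using x y d by (intro lsc) auto
      also have "\<dots> \<le> liminf (\<lambda>n. ereal (C * d n) + F (d n) (y (d n)))"
      proof (intro Liminf_mono always_eventually allI)
        show "G (y (d n)) \<le> ereal (C * d n) + F (d n) (y (d n))" for n
          using lower[OF d(1), of "y (d n)" n] by (simp add: add.commute)
      qed
      also have "\<dots> = 0 + liminf (\<lambda>n. F (d n) (y (d n)))"
      proof (rule ereal_liminf_lim_add)
        have "(\<lambda>n. C * d n) \<longlonglongrightarrow> C * 0"
          by (intro tendsto_intros d)
        then show "(\<lambda>n. ereal (C * d n)) \<longlonglongrightarrow> 0"
          by (metis mult_zero_right tendsto_ereal zero_ereal_def)
      qed simp
      finally have "G x \<le> liminf (\<lambda>n. F (d n) (y (d n)))"
        by simp
      with c show "\<forall>\<^sub>F n in sequentially. c < F (d n) (y (d n))"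
        unfolding le_Liminf_iff by blast
    qed
  qed
qed

section \<open>Measurability and lower semicontinuity of the integrand\<close>

lemma tendsto_weakly_if_tendsto:
  assumes "x \<longlonglongrightarrow> l"
  shows "tendsto_weakly x l sequentially"
  unfolding tendsto_weakly_on_def
proof
  fix \<phi> :: "'a \<Rightarrow> real" assume "\<phi> \<in> dual_on UNIV norm"
  then obtain C where C: "\<And>u v. \<phi> (u + v) = \<phi> u + \<phi> v" "\<And>c v. \<phi> (c *\<^sub>R v) = c * \<phi> v"
    "\<And>v. \<bar>\<phi> v\<bar> \<le> C * norm v"
    by (auto simp: dual_on_def)
  then have "bounded_linear \<phi>"
    by (intro bounded_linear_intro[where K = C]) (auto simp: mult.commute)
  then show "(\<lambda>i. \<phi> (x i)) \<longlonglongrightarrow> \<phi> l"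
    using assms by (rule bounded_linear.tendsto)
qed

text \<open>Norm convergence implies weak convergence, so the sublevel sets are closed in the norm
  topology and therefore Borel.\<close>

lemma seq_weakly_lsc_borel_measurable:
  assumes "seq_weakly_lsc g"
  shows "g \<in> borel_measurable borel"
  unfolding borel_measurable_iff_Iic_ereal
proof
  fix a :: ereal
  have "closed (g -` {..a})"
    unfolding closed_sequential_limits
  proof (intro allI impI, elim conjE)
    fix x l assume x: "\<forall>n. x n \<in> g -` {..a}" "x \<longlonglongrightarrow> l"
    have "g l \<le> liminf (\<lambda>n. g (x n))"
      using assms tendsto_weakly_if_tendsto[OF x(2)] by (simp add: seq_weakly_lsc_def)
    also have "\<dots> \<le> a"
      using x(1) by (intro Liminf_le) auto
    finally show "l \<in> g -` {..a}"
      by simp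
  qed
  then show "g -` {..a} \<inter> space borel \<in> sets borel"
    by simp
qed

lemma pos_part_measurable: "pos_part \<in> borel_measurable borel"
  unfolding pos_part_def by measurable

text \<open>This is the pointwise inequality to which Fatou's lemma is applied; the shift varies
  along the sequence as well.\<close>

lemma pos_part_diff_liminf:
  assumes "c \<le> liminf a" and "\<gamma>s \<longlonglongrightarrow> \<gamma>"
  shows "pos_part (c - ereal \<gamma>) \<le> liminf (\<lambda>n. pos_part (a n - ereal (\<gamma>s n)))"
proof -
  have "(\<lambda>n. ereal (- \<gamma>s n)) \<longlonglongrightarrow> ereal (- \<gamma>)"
    using assms(2) by (intro tendsto_intros)
  then have "liminf (\<lambda>n. ereal (- \<gamma>s n) + a n) = ereal (- \<gamma>) + liminf a"
    by (rule ereal_liminf_lim_add) simp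
  then have le: "c - ereal \<gamma> \<le> liminf (\<lambda>n. a n - ereal (\<gamma>s n))"
    using add_left_mono[OF assms(1), of "ereal (- \<gamma>)"] by (simp add: minus_ereal_def add.commute)
  show ?thesis
    unfolding le_Liminf_iff
  proof (intro allI impI)
    fix y assume y: "y < pos_part (c - ereal \<gamma>)"
    \<comment> \<open>As \<open>enn2ereal y\<close> is nonnegative, it lies strictly below
      \<open>max 0 z\<close> exactly if it lies strictly below \<open>z\<close>. Thus the liminf
      inequality passes through \<open>pos_part\<close> by its strict lower bounds.\<close>
    have *: "y < pos_part z \<longleftrightarrow> enn2ereal y < z" for z
      unfolding pos_part_def using enn2ereal_nonneg[of y]
      by (auto simp: less_ennreal.rep_eq enn2ereal_e2ennreal less_max_iff_disj not_le[symmetric])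
    with y le show "\<forall>\<^sub>F n in sequentially. y < pos_part (a n - ereal (\<gamma>s n))"
      unfolding le_Liminf_iff by auto
  qed
qed

section \<open>From the smoothing error to the functionals\<close>

text \<open>Against a weight of mass at most 1 a constant error does not grow. The disjunction lets
  either side be the measurable one: in both applications this is the exact positive part, once on
  the right and once on the left.\<close>

lemma nn_integral_weight_le:
  assumes [measurable]: "\<rho> \<in> borel_measurable M" and \<rho>: "(\<integral>\<^sup>+x. \<rho> x \<partial>M) \<le> 1"
    and le: "\<And>x. u x \<le> w x + e"
    and meas: "u \<in> borel_measurable M \<or> w \<in> borel_measurable M"
  shows "(\<integral>\<^sup>+x. u x * \<rho> x \<partial>M) \<le> (\<integral>\<^sup>+x. w x * \<rho> x \<partial>M) + (e::ennreal)"
proof -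
  have *: "(\<integral>\<^sup>+x. u x * \<rho> x \<partial>M) \<le> (\<integral>\<^sup>+x. v x * \<rho> x \<partial>M) + e"
    if [measurable]: "v \<in> borel_measurable M" and "\<And>x. u x \<le> v x + e" for v
  proof -
    have "(\<integral>\<^sup>+x. u x * \<rho> x \<partial>M) \<le> (\<integral>\<^sup>+x. v x * \<rho> x + e * \<rho> x \<partial>M)"
      using that(2) by (intro nn_integral_mono) (metis distrib_right mult_right_mono zero_le)
    also have "\<dots> = (\<integral>\<^sup>+x. v x * \<rho> x \<partial>M) + e * (\<integral>\<^sup>+x. \<rho> x \<partial>M)"
      by (simp add: nn_integral_add nn_integral_cmult)
    also have "\<dots> \<le> (\<integral>\<^sup>+x. v x * \<rho> x \<partial>M) + e"
      using mult_left_mono[OF \<rho>, of e] by (simp add: add_left_mono)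
    finally show ?thesis .
  qed
  show ?thesis
    using meas
  proof
    assume "w \<in> borel_measurable M"
    then show ?thesis using le by (rule *)
  next
    assume [measurable]: "u \<in> borel_measurable M"
    show ?thesis
    proof (cases "e = top")
      case False
      \<comment> \<open>Subtracting e on the measurable side avoids additivity of the integral of w.\<close>
      have "(\<integral>\<^sup>+x. u x * \<rho> x \<partial>M) \<le> (\<integral>\<^sup>+x. (u x - e) * \<rho> x \<partial>M) + e"
        by (intro *) (auto simp: diff_add_cancel_ennreal ennreal_minus_le_iff[symmetric] add.commute
            intro: ennreal_minus_le_iff[THEN iffD1, THEN conjunct1, OF order_refl])
      also have "\<dots> \<le> (\<integral>\<^sup>+x. w x * \<rho> x \<partial>M) + e"
        using le False
        by (intro add_right_mono nn_integral_mono mult_right_mono)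
          (auto simp: ennreal_minus_le_iff add.commute)
      finally show ?thesis .
    qed simp
  qed
qed

text \<open>For nonzero perturbations both sides are infinite. Otherwise the error is multiplied by
  \<open>\<kappa>\<close>, and nonnegativity of all terms lets the extended real product
  distribute.\<close>

lemma rockafellian_le:
  assumes \<kappa>: "0 \<le> \<kappa>" and e: "0 \<le> e"
    and le: "\<And>z \<gamma>. (\<integral>\<^sup>+\<xi>. h (g (s \<xi> z) - ereal \<gamma>) * RN_deriv \<mu> P \<xi> \<partial>\<mu>)
      \<le> (\<integral>\<^sup>+\<xi>. h' (g (s \<xi> z) - ereal \<gamma>) * RN_deriv \<mu> P \<xi> \<partial>\<mu>) + ennreal e"
  shows "rockafellian h f\<^sub>0 g s \<kappa> P \<mu> v \<le> rockafellian h' f\<^sub>0 g s \<kappa> P \<mu> v + ereal (\<kappa> * e)"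
proof -
  obtain z \<gamma> t tt where v: "v = (z, \<gamma>, t, tt)" by (metis prod_cases4)
  have "enn2ereal (\<integral>\<^sup>+\<xi>. h (g (s \<xi> z) - ereal \<gamma>) * RN_deriv \<mu> P \<xi> \<partial>\<mu>)
      \<le> enn2ereal (\<integral>\<^sup>+\<xi>. h' (g (s \<xi> z) - ereal \<gamma>) * RN_deriv \<mu> P \<xi> \<partial>\<mu>) + ereal e"
    using le[of z \<gamma>] e by (simp add: less_eq_ennreal.rep_eq plus_ennreal.rep_eq enn2ereal_ennreal)
  from ereal_mult_left_mono[OF this, of "ereal \<kappa>"] \<kappa> e show ?thesis
    unfolding v rockafellian_def
    by (auto simp: ereal_right_distrib add.assoc add_left_mono)
qed

section \<open>Bounded functionals on the product space\<close>

lemma dual_on_compose: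
  assumes "\<phi> \<in> dual_on V N"
    and "\<And>u v. u \<in> W \<Longrightarrow> v \<in> W \<Longrightarrow> \<pi> (u + v) = \<pi> u + \<pi> v"
    and "\<And>c v. v \<in> W \<Longrightarrow> \<pi> (c *\<^sub>R v) = c *\<^sub>R \<pi> v"
    and "\<And>v. v \<in> W \<Longrightarrow> \<pi> v \<in> V \<and> 0 \<le> N (\<pi> v) \<and> N (\<pi> v) \<le> N' v"
  shows "(\<lambda>v. \<phi> (\<pi> v)) \<in> dual_on W N'"
proof -
  obtain C where C: "\<forall>v\<in>V. \<bar>\<phi> v\<bar> \<le> C * N v"
    using assms(1) unfolding dual_on_def by blast
  \<comment> \<open>The constant \<open>C\<close> may be negative, so its absolute value is used
    when passing to the larger norm.\<close>
  have "\<bar>\<phi> (\<pi> v)\<bar> \<le> \<bar>C\<bar> * N' v" if "v \<in> W" for v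
  proof -
    have "\<bar>\<phi> (\<pi> v)\<bar> \<le> C * N (\<pi> v)"
      using C assms(4)[OF that] by blast
    also have "\<dots> \<le> \<bar>C\<bar> * N' v"
      using assms(4)[OF that] by (intro mult_mono) auto
    finally show ?thesis .
  qed
  then have "\<exists>C. \<forall>v\<in>W. \<bar>\<phi> (\<pi> v)\<bar> \<le> C * N' v"
    by blast
  moreover have "\<phi> (\<pi> (u + v)) = \<phi> (\<pi> u) + \<phi> (\<pi> v)" if "u \<in> W" "v \<in> W" for u v
    using assms(1) assms(2)[OF that] assms(4) that by (auto simp: dual_on_def)
  moreover have "\<phi> (\<pi> (c *\<^sub>R v)) = c * \<phi> (\<pi> v)" if "v \<in> W" for c v
    using assms(1) assms(3)[OF that] assms(4)[OF that] by (auto simp: dual_on_def)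
  ultimately show ?thesis
    by (simp add: dual_on_def)
qed

text \<open>The coordinate projections do not increase the norm. Hence weak convergence in the
  product gives weak convergence of each component, and ordinary convergence of the real
  one.\<close>

lemma dual_on_rock_space:
  fixes \<mu> :: "'x::real_normed_vector measure"
  shows "\<phi>\<^sub>1 \<in> dual_on (UNIV :: 'z::real_normed_vector set) norm \<Longrightarrow>
      (\<lambda>v. \<phi>\<^sub>1 (fst v)) \<in> dual_on (rock_space q q' \<mu>) (rock_norm q q' \<mu>)"
    and "(\<lambda>v :: 'z \<times> real \<times> ('x \<Rightarrow> real) \<times> ('x \<Rightarrow> 'x). fst (snd v))
      \<in> dual_on (rock_space q q' \<mu>) (rock_norm q q' \<mu>)"
    and "\<phi>\<^sub>3 \<in> dual_on (Lp_set q \<mu>) (Lp_norm q \<mu>) \<Longrightarrow>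
      (\<lambda>v :: 'z \<times> real \<times> ('x \<Rightarrow> real) \<times> ('x \<Rightarrow> 'x). \<phi>\<^sub>3 (fst (snd (snd v))))
      \<in> dual_on (rock_space q q' \<mu>) (rock_norm q q' \<mu>)"
    and "\<phi>\<^sub>4 \<in> dual_on (Lp_set q' \<mu>) (Lp_norm q' \<mu>) \<Longrightarrow>
      (\<lambda>v :: 'z \<times> real \<times> ('x \<Rightarrow> real) \<times> ('x \<Rightarrow> 'x). \<phi>\<^sub>4 (snd (snd (snd v))))
      \<in> dual_on (rock_space q q' \<mu>) (rock_norm q q' \<mu>)"
proof -
  have "(\<lambda>\<gamma>. \<gamma>) \<in> dual_on UNIV (norm :: real \<Rightarrow> real)"
    by (auto simp: dual_on_def intro: exI[of _ 1])
  then show "(\<lambda>v :: 'z \<times> real \<times> ('x \<Rightarrow> real) \<times> ('x \<Rightarrow> 'x). fst (snd v))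
      \<in> dual_on (rock_space q q' \<mu>) (rock_norm q q' \<mu>)"
    by (rule dual_on_compose) (auto simp: rock_space_def rock_norm_def Lp_norm_nonneg)
qed (erule dual_on_compose; auto simp: rock_space_def rock_norm_def Lp_norm_nonneg)+

lemma rock_norm_0: "rock_norm q q' \<mu> 0 = 0"
  by (simp add: rock_norm_def zero_prod_def Lp_norm_eq_0)

lemma dual_on_Lp_eq_0:
  assumes "\<phi> \<in> dual_on (Lp_set p M) (Lp_norm p M)" and "f \<in> Lp_set p M" and "AE x in M. f x = 0"
  shows "\<phi> f = 0"
  using assms by (force simp: dual_on_def Lp_norm_eq_0)

text \<open>Some bounded functional is nonzero at \<open>x\<close> but vanishes wherever both
  perturbations are zero almost everywhere. Under weak convergence its values at \<open>y n\<close>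
  are eventually nonzero.\<close>

lemma eventually_not_AE_0:
  fixes x :: "'z::real_normed_vector \<times> real \<times> ('x \<Rightarrow> real) \<times> ('x \<Rightarrow> 'x::real_normed_vector)"
  assumes "sigma_finite_measure \<mu>" and "1 \<le> q" and "1 \<le> q'"
    and x: "x \<in> rock_space q q' \<mu>" and y: "\<And>n. y n \<in> rock_space q q' \<mu>"
    and weak: "tendsto_weakly_on (rock_space q q' \<mu>) (rock_norm q q' \<mu>) y x sequentially"
    and nz: "\<not> (AE \<xi> in \<mu>. fst (snd (snd x)) \<xi> = 0 \<and> snd (snd (snd x)) \<xi> = 0)"
  shows "\<forall>\<^sub>F n in sequentially.
    \<not> (AE \<xi> in \<mu>. fst (snd (snd (y n))) \<xi> = 0 \<and> snd (snd (snd (y n))) \<xi> = 0)"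
proof -
  have mem: "fst (snd (snd v)) \<in> Lp_set q \<mu>" "snd (snd (snd v)) \<in> Lp_set q' \<mu>"
    if "v \<in> rock_space q q' \<mu>" for v :: "'z \<times> real \<times> ('x \<Rightarrow> real) \<times> ('x \<Rightarrow> 'x)"
    using that by (auto simp: rock_space_def)
  obtain \<phi> where \<phi>: "\<phi> \<in> dual_on (rock_space q q' \<mu>) (rock_norm q q' \<mu>)" "\<phi> x \<noteq> 0"
    and zero: "\<And>v. v \<in> rock_space q q' \<mu> \<Longrightarrow>
      AE \<xi> in \<mu>. fst (snd (snd v)) \<xi> = 0 \<and> snd (snd (snd v)) \<xi> = 0 \<Longrightarrow> \<phi> v = 0"
  proof (cases "AE \<xi> in \<mu>. fst (snd (snd x)) \<xi> = 0")
    case False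
    then obtain \<phi> where \<phi>: "\<phi> \<in> dual_on (Lp_set q \<mu>) (Lp_norm q \<mu>)" "\<phi> (fst (snd (snd x))) \<noteq> 0"
      using Lp_separating_functional[OF assms(1,2) mem(1)[OF x]] by blast
    show thesis
      by (rule that[OF dual_on_rock_space(3)[OF \<phi>(1)] \<phi>(2)], rule dual_on_Lp_eq_0[OF \<phi>(1)])
        (auto simp: mem)
  next
    case True
    with nz have "\<not> (AE \<xi> in \<mu>. snd (snd (snd x)) \<xi> = 0)" by auto
    then obtain \<phi> where \<phi>: "\<phi> \<in> dual_on (Lp_set q' \<mu>) (Lp_norm q' \<mu>)" "\<phi> (snd (snd (snd x))) \<noteq> 0"
      using Lp_separating_functional[OF assms(1,3) mem(2)[OF x]] by blast
    show thesis
      by (rule that[OF dual_on_rock_space(4)[OF \<phi>(1)] \<phi>(2)], rule dual_on_Lp_eq_0[OF \<phi>(1)])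
        (auto simp: mem)
  qed
  have "(\<lambda>n. \<phi> (y n)) \<longlonglongrightarrow> \<phi> x"
    using weak \<phi>(1) by (auto simp: tendsto_weakly_on_def)
  from tendsto_imp_eventually_ne[OF this \<phi>(2)] show ?thesis
  proof (rule eventually_mono)
    show "\<not> (AE \<xi> in \<mu>. fst (snd (snd (y n))) \<xi> = 0 \<and> snd (snd (snd (y n))) \<xi> = 0)"
      if "\<phi> (y n) \<noteq> 0" for n
      using zero[OF y] that by blast
  qed
qed

section \<open>Lower semicontinuity of the limit functional\<close>

lemma Phi_seq_weakly_lsc:
  fixes f\<^sub>0 :: "'z::real_normed_vector \<Rightarrow> ereal"
    and g :: "'u::real_normed_vector \<Rightarrow> ereal"
    and s :: "'x::real_normed_vector \<Rightarrow> 'z \<Rightarrow> 'u"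
  assumes s_meas: "\<And>z. (\<lambda>\<xi>. s \<xi> z) \<in> borel_measurable P"
    and s_cont: "\<And>\<xi> zs z. tendsto_weakly zs z sequentially \<Longrightarrow>
           tendsto_weakly (\<lambda>n. s \<xi> (zs n)) (s \<xi> z) sequentially"
    and f0: "\<And>z. f\<^sub>0 z \<noteq> - \<infinity>" and lsc: "seq_weakly_lsc f\<^sub>0" "seq_weakly_lsc g"
    and \<kappa>: "0 \<le> \<kappa>"
    and \<mu>: "sigma_finite_measure \<mu>" and sets: "sets \<mu> = sets P"
    and ac: "absolutely_continuous \<mu> P"
    and q: "1 \<le> q" "1 \<le> q'"
    and x: "x \<in> rock_space q q' \<mu>" and y: "\<And>n. y n \<in> rock_space q q' \<mu>"
    and weak: "tendsto_weakly_on (rock_space q q' \<mu>) (rock_norm q q' \<mu>) y x sequentially"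
  shows "Phi f\<^sub>0 g s \<kappa> P \<mu> x \<le> liminf (\<lambda>n. Phi f\<^sub>0 g s \<kappa> P \<mu> (y n))"
proof (cases "AE \<xi> in \<mu>. fst (snd (snd x)) \<xi> = 0 \<and> snd (snd (snd x)) \<xi> = 0")
  case False
  have "\<forall>\<^sub>F n in sequentially. \<infinity> \<le> Phi f\<^sub>0 g s \<kappa> P \<mu> (y n)"
    using eventually_not_AE_0[OF \<mu> q x y weak False]
    by (auto elim!: eventually_mono simp: Phi_def rockafellian_def split: prod.split)
  then have "\<infinity> \<le> liminf (\<lambda>n. Phi f\<^sub>0 g s \<kappa> P \<mu> (y n))"
    by (rule Liminf_bounded)
  then show ?thesis by simp
next
  case True
  define z \<gamma> zs \<gamma>s where "z = fst x" and "\<gamma> = fst (snd x)"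
    and "zs = (\<lambda>n. fst (y n))" and "\<gamma>s = (\<lambda>n. fst (snd (y n)))"
  note weakD = weak[unfolded tendsto_weakly_on_def, rule_format]
  have zs: "tendsto_weakly zs z sequentially"
    unfolding tendsto_weakly_on_def z_def zs_def
    by (intro ballI) (rule weakD[OF dual_on_rock_space(1)])
  have \<gamma>s: "\<gamma>s \<longlonglongrightarrow> \<gamma>"
    unfolding \<gamma>_def \<gamma>s_def by (rule weakD[OF dual_on_rock_space(2)])
  define I where "I = (\<lambda>z \<gamma>. \<integral>\<^sup>+\<xi>. pos_part (g (s \<xi> z) - ereal \<gamma>) * RN_deriv \<mu> P \<xi> \<partial>\<mu>)"
  note seq_weakly_lsc_borel_measurable[OF lsc(2), measurable] pos_part_measurable [measurable]
    s_meas [measurable]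
  have [measurable]: "(\<lambda>\<xi>. s \<xi> z) \<in> borel_measurable \<mu>" for z
    using s_meas by (simp cong: measurable_cong_sets add: sets)
  \<comment> \<open>The weight is the density of \<open>P\<close>, so the integral can be taken with
    respect to \<open>P\<close>, where Fatou's lemma is applied.\<close>
  have I_eq: "I z \<gamma> = (\<integral>\<^sup>+\<xi>. pos_part (g (s \<xi> z) - ereal \<gamma>) \<partial>P)" for z \<gamma>
    unfolding I_def
    using sigma_finite_measure.RN_deriv_nn_integral[OF \<mu> ac sets[symmetric],
        of "\<lambda>\<xi>. pos_part (g (s \<xi> z) - ereal \<gamma>)"]
    by (simp add: mult.commute)
  have "I z \<gamma> \<le> (\<integral>\<^sup>+\<xi>. liminf (\<lambda>n. pos_part (g (s \<xi> (zs n)) - ereal (\<gamma>s n))) \<partial>P)"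
    unfolding I_eq
  proof (rule nn_integral_mono)
    fix \<xi>
    have "g (s \<xi> z) \<le> liminf (\<lambda>n. g (s \<xi> (zs n)))"
      using lsc(2) s_cont[OF zs] by (auto simp: seq_weakly_lsc_def)
    then show "pos_part (g (s \<xi> z) - ereal \<gamma>)
        \<le> liminf (\<lambda>n. pos_part (g (s \<xi> (zs n)) - ereal (\<gamma>s n)))"
      using \<gamma>s by (rule pos_part_diff_liminf)
  qed
  also have "\<dots> \<le> liminf (\<lambda>n. I (zs n) (\<gamma>s n))"
    unfolding I_eq by (intro nn_integral_liminf) measurable
  finally have "enn2ereal (I z \<gamma>) \<le> enn2ereal (liminf (\<lambda>n. I (zs n) (\<gamma>s n)))"
    by (simp add: less_eq_ennreal.rep_eq)
  also have "\<dots> = liminf (\<lambda>n. enn2ereal (I (zs n) (\<gamma>s n)))"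
    by (rule Liminf_compose_continuous_mono[symmetric])
      (auto simp: continuous_on_enn2ereal mono_def less_eq_ennreal.rep_eq)
  finally have "ereal \<kappa> * enn2ereal (I z \<gamma>) \<le> liminf (\<lambda>n. ereal \<kappa> * enn2ereal (I (zs n) (\<gamma>s n)))"
    using \<kappa> by (subst Liminf_ereal_mult_left) (auto intro: ereal_mult_left_mono)
  moreover have fl: "f\<^sub>0 z \<le> liminf (\<lambda>n. f\<^sub>0 (zs n))"
    using lsc(1) zs by (simp add: seq_weakly_lsc_def)
  ultimately have "f\<^sub>0 z + ereal \<kappa> * enn2ereal (I z \<gamma>)
      \<le> liminf (\<lambda>n. f\<^sub>0 (zs n)) + liminf (\<lambda>n. ereal \<kappa> * enn2ereal (I (zs n) (\<gamma>s n)))"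
    by (intro add_mono)
  \<comment> \<open>Superadditivity of liminf requires that opposite infinities do not meet: the
    first liminf is above \<open>f\<^sub>0 z\<close>, which is not minus infinity, and the second is
    nonnegative.\<close>
  also have "\<dots> \<le> liminf (\<lambda>n. f\<^sub>0 (zs n) + ereal \<kappa> * enn2ereal (I (zs n) (\<gamma>s n)))"
  proof (rule ereal_liminf_add_mono)
    have "0 \<le> liminf (\<lambda>n. ereal \<kappa> * enn2ereal (I (zs n) (\<gamma>s n)))"
      using \<kappa> by (intro Liminf_bounded) auto
    moreover have "liminf (\<lambda>n. f\<^sub>0 (zs n)) \<noteq> - \<infinity>"
      using fl f0[of z] by auto
    ultimately show "\<not> (liminf (\<lambda>n. f\<^sub>0 (zs n)) = \<infinity> \<and>
        liminf (\<lambda>n. ereal \<kappa> * enn2ereal (I (zs n) (\<gamma>s n))) = - \<infinity> \<or>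
        liminf (\<lambda>n. f\<^sub>0 (zs n)) = - \<infinity> \<and>
        liminf (\<lambda>n. ereal \<kappa> * enn2ereal (I (zs n) (\<gamma>s n))) = \<infinity>)"
      by auto
  qed
  finally have "ereal \<gamma> + (f\<^sub>0 z + ereal \<kappa> * enn2ereal (I z \<gamma>))
      \<le> ereal \<gamma> + liminf (\<lambda>n. f\<^sub>0 (zs n) + ereal \<kappa> * enn2ereal (I (zs n) (\<gamma>s n)))"
    by (intro add_left_mono)
  \<comment> \<open>The real terms \<open>\<gamma>s n\<close> converge to a finite limit, so they
    enter the liminf with equality, whatever their sign.\<close>
  also have "\<dots> = liminf (\<lambda>n. ereal (\<gamma>s n) + (f\<^sub>0 (zs n) + ereal \<kappa> * enn2ereal (I (zs n) (\<gamma>s n))))"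
    using \<gamma>s by (intro ereal_liminf_lim_add[symmetric]) (auto intro: tendsto_ereal)
  \<comment> \<open>The points \<open>y n\<close> may have nonzero perturbations. There
    \<open>Phi\<close> is infinite, so the formula for zero perturbations is a lower bound in every
    case.\<close>
  also have "\<dots> \<le> liminf (\<lambda>n. Phi f\<^sub>0 g s \<kappa> P \<mu> (y n))"
    by (intro Liminf_mono always_eventually)
      (auto simp: Phi_def rockafellian_def I_def zs_def \<gamma>s_def add_ac split: prod.split)
  also have "ereal \<gamma> + (f\<^sub>0 z + ereal \<kappa> * enn2ereal (I z \<gamma>)) = Phi f\<^sub>0 g s \<kappa> P \<mu> x"
    using True by (auto simp: Phi_def rockafellian_def I_def z_def \<gamma>_def add_ac split: prod.split)
  finally show ?thesis .
qed

theorem theorem4p4: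
  fixes f\<^sub>0 :: "'z::banach \<Rightarrow> ereal"
    and g :: "'u::banach \<Rightarrow> ereal"
    and s :: "'x::real_normed_vector \<Rightarrow> 'z \<Rightarrow> 'u"
    and P \<mu> :: "'x measure"
    and \<beta> \<kappa> q q' :: real
    and \<zeta> :: "real \<Rightarrow> real"
  assumes "reflexive_space TYPE('z)"
    and "prob_space P" and "space P = UNIV"
    and "\<And>z. (\<lambda>\<xi>. s \<xi> z) \<in> borel_measurable P"
    and "\<And>\<xi>s \<xi> zs z. \<xi>s \<longlonglongrightarrow> \<xi> \<Longrightarrow> tendsto_weakly zs z sequentially \<Longrightarrow>
           tendsto_weakly (\<lambda>n. s (\<xi>s n) (zs n)) (s \<xi> z) sequentially"
    and "\<And>z. f\<^sub>0 z \<noteq> - \<infinity>" and "\<exists>z. f\<^sub>0 z \<noteq> \<infinity>"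
    and "seq_weakly_lsc f\<^sub>0" and "seq_weakly_lsc g"
    and "0 < \<beta>" and "\<beta> < 1" and "\<kappa> = 1 / (1 - \<beta>)"
    and "sigma_finite_measure \<mu>" and "sets \<mu> = sets P" and "absolutely_continuous \<mu> P"
    and "1 < q" and "1 < q'" and "1 / q + 1 / q' = 1"
    and "smoothing_kernel \<zeta>"
  shows "mosco_converges_on (rock_space q q' \<mu>) (rock_norm q q' \<mu>)
    (\<lambda>\<delta>. Phi_smooth \<zeta> \<delta> f\<^sub>0 g s \<kappa> P \<mu>) (Phi f\<^sub>0 g s \<kappa> P \<mu>)"
proof -
  interpret P: prob_space P by fact
  interpret sigma_finite_measure \<mu> by fact
  define m where "m = (\<integral>x. \<zeta> x * \<bar>x\<bar> \<partial>lborel)"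
  have m: "m \<ge> 0"
    using assms(19) by (simp add: m_def smoothing_kernel_def)
  have \<kappa>: "\<kappa> \<ge> 0"
    using assms(11,12) by simp
  have "(\<integral>\<^sup>+\<xi>. RN_deriv \<mu> P \<xi> \<partial>\<mu>) = (\<integral>\<^sup>+\<xi>. 1 \<partial>P)"
    using assms(14,15) by (subst RN_deriv_nn_integral) auto
  then have \<rho>: "(\<integral>\<^sup>+\<xi>. RN_deriv \<mu> P \<xi> \<partial>\<mu>) \<le> 1"
    by (simp add: P.emeasure_space_1)
  note seq_weakly_lsc_borel_measurable[OF assms(9), measurable] pos_part_measurable [measurable]
  have [measurable]: "(\<lambda>\<xi>. s \<xi> z) \<in> borel_measurable \<mu>" for z
    using assms(4) by (simp cong: measurable_cong_sets add: assms(14))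
  have meas: "(\<lambda>\<xi>. pos_part (g (s \<xi> z) - ereal \<gamma>)) \<in> borel_measurable \<mu>" for z \<gamma>
    by measurable
  note weight = nn_integral_weight_le[OF borel_measurable_RN_deriv \<rho>]
  show ?thesis
  proof (rule mosco_converges_on_if_uniform[where C = "\<kappa> * m"])
    \<comment> \<open>Constant sequences in the first argument of \<open>s\<close> give the weak
      continuity at fixed \<open>\<xi>\<close> used in the pointwise comparison under the
      integral.\<close>
    show "Phi f\<^sub>0 g s \<kappa> P \<mu> x \<le> liminf (\<lambda>n. Phi f\<^sub>0 g s \<kappa> P \<mu> (y n))"
      if "x \<in> rock_space q q' \<mu>" "\<And>n. y n \<in> rock_space q q' \<mu>"
        "tendsto_weakly_on (rock_space q q' \<mu>) (rock_norm q q' \<mu>) y x sequentially" for x y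
      using Phi_seq_weakly_lsc[OF assms(4) assms(5)[OF tendsto_const] assms(6,8,9) \<kappa> assms(13,14,15) _ _ that]
        assms(16,17) by simp
  next
    show "rock_norm q q' \<mu> 0 = 0" by (rule rock_norm_0)
  next
    fix \<delta> :: real and v assume \<delta>: "\<delta> > 0"
    have "0 \<le> \<delta> * m" using \<delta> m by simp
    note le = rockafellian_le[OF \<kappa> this]
    show "Phi_smooth \<zeta> \<delta> f\<^sub>0 g s \<kappa> P \<mu> v \<le> Phi f\<^sub>0 g s \<kappa> P \<mu> v + ereal (\<kappa> * m * \<delta>)"
      unfolding Phi_smooth_def Phi_def mult.assoc[of \<kappa>] mult.commute[of m]
      by (rule le, rule weight[OF smooth_pos_part_le[OF assms(19) \<delta>, folded m_def]]) (simp add: meas)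
    show "Phi f\<^sub>0 g s \<kappa> P \<mu> v \<le> Phi_smooth \<zeta> \<delta> f\<^sub>0 g s \<kappa> P \<mu> v + ereal (\<kappa> * m * \<delta>)"
      unfolding Phi_smooth_def Phi_def mult.assoc[of \<kappa>] mult.commute[of m]
      by (rule le, rule weight[OF pos_part_le[OF assms(19) \<delta>, folded m_def]]) (simp add: meas)
  qed
qed

end
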